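(* Let $X$ be a finite set and $\mathcal{R}\subseteq X\times X$ a symmetric reflexive relation on $X$. Let $\phi\in\mathbb{P}(\ell^2(X))$ be a pure state with support $S\subseteq X$. The restriction of $\phi$ to $E(\mathcal{R})$ is pure if and only if the restriction of the relation $\mathcal{R}$ to $S$ generates the full equivalence relation $S\times S$ on $S$.
   Context: $\mathcal{K}(\ell^2(X))$ is the algebra of all linear operators on $\ell^2(X)$ with matrix units $e_{xy}$, and $E(\mathcal{R})\subseteq\mathcal{K}(\ell^2(X))$ is the linear span of the $e_{xy}$ with $(x,y)\in\mathcal{R}$, with order inherited from $\mathcal{K}(\ell^2(X))$. $\mathbb{P}(\ell^2(X))$ is the set of pure states of $\mathcal{K}(\ell^2(X))$, i.e. of vector states $\phi(B)=\langle v,Bv\rangle$ with $v\in\ell^2(X)$ a unit vector; the support of $\phi$ is $S=\{x\in X: v_x\neq0\}$. A state on $E(\mathcal{R})$ is a positive linear functional of norm one, and it is pure if it is an extreme point of the convex set of states on $E(\mathcal{R})$. *)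

theory Defs
  imports "HOL-Analysis.Analysis"
begin

text \<open>
  The finite set \<open>X\<close> is the type \<open>'x :: finite\<close>. The Hilbert space of square-summable functions
  on \<open>X\<close> is \<open>complex ^ 'x\<close> (whose library norm is the Hilbert space norm), and operators on it are
  identified with their matrices \<open>complex ^ 'x ^ 'x\<close>, acting by \<open>*v\<close>.
\<close>

text \<open>The library's \<open>\<bullet>\<close> on \<open>complex ^ 'x\<close> is only the real part of this inner product.\<close>

definition cinner :: "complex ^ 'x \<Rightarrow> complex ^ 'x \<Rightarrow> complex" where
  "cinner v w = (\<Sum>x\<in>UNIV. cnj (v $ x) * w $ x)"

definition vector_state :: "complex ^ 'x \<Rightarrow> complex ^ 'x ^ 'x \<Rightarrow> complex" where
  "vector_state v B = cinner v (B *v v)"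

definition support :: "complex ^ 'x \<Rightarrow> 'x set" where
  "support v = {x. v $ x \<noteq> 0}"

text \<open>\<open>*s\<close> on the type \<open>complex ^ 'x ^ 'x\<close> would take a vector, not a complex number, as scalar.\<close>

definition cscale :: "complex \<Rightarrow> complex ^ 'x ^ 'x \<Rightarrow> complex ^ 'x ^ 'x" where
  "cscale c A = (\<chi> i j. c * A $ i $ j)"

global_interpretation cmat: vector_space "cscale :: complex \<Rightarrow> complex ^ 'x ^ 'x \<Rightarrow> complex ^ 'x ^ 'x"
  by unfold_locales (simp_all add: cscale_def vec_eq_iff algebra_simps)

definition matrix_unit :: "'x \<Rightarrow> 'x \<Rightarrow> complex ^ 'x ^ 'x" where
  "matrix_unit x y = (\<chi> i j. if i = x \<and> j = y then 1 else 0)"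

definition E :: "('x \<times> 'x) set \<Rightarrow> (complex ^ 'x ^ 'x) set" where
  "E R = cmat.span {matrix_unit x y | x y. (x, y) \<in> R}"

definition positive_op :: "complex ^ 'x ^ 'x \<Rightarrow> bool" where
  "positive_op A \<longleftrightarrow> (\<forall>v. cinner v (A *v v) \<in> \<real>\<^sub>\<ge>\<^sub>0)"

definition op_norm :: "complex ^ 'x ^ 'x \<Rightarrow> real" where
  "op_norm A = onorm ((*v) A)"

text \<open>
  Functionals on a subspace \<open>V\<close> of operators are functions in \<open>extensional V\<close>, so that they are
  equal iff they agree on \<open>V\<close>, and restriction to \<open>V\<close> is the library's \<open>restrict\<close>.
\<close>

definition linear_functional_on ::
    "(complex ^ 'x ^ 'x) set \<Rightarrow> (complex ^ 'x ^ 'x \<Rightarrow> complex) \<Rightarrow> bool" where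
  "linear_functional_on V f \<longleftrightarrow> f \<in> extensional V \<and>
     (\<forall>A\<in>V. \<forall>B\<in>V. f (A + B) = f A + f B) \<and> (\<forall>c. \<forall>A\<in>V. f (cscale c A) = c * f A)"

definition positive_functional_on ::
    "(complex ^ 'x ^ 'x) set \<Rightarrow> (complex ^ 'x ^ 'x \<Rightarrow> complex) \<Rightarrow> bool" where
  "positive_functional_on V f \<longleftrightarrow> (\<forall>A\<in>V. positive_op A \<longrightarrow> f A \<in> \<real>\<^sub>\<ge>\<^sub>0)"

text \<open>
  The supremum is over a nonempty set which is bounded above when \<open>f\<close> is linear on the
  (finite-dimensional) subspace \<open>V\<close>.
\<close>

definition functional_norm_on ::
    "(complex ^ 'x ^ 'x) set \<Rightarrow> (complex ^ 'x ^ 'x \<Rightarrow> complex) \<Rightarrow> real" where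
  "functional_norm_on V f = (SUP A\<in>{A \<in> V. op_norm A \<le> 1}. cmod (f A))"

definition states :: "(complex ^ 'x ^ 'x) set \<Rightarrow> (complex ^ 'x ^ 'x \<Rightarrow> complex) set" where
  "states V = {f. linear_functional_on V f \<and> positive_functional_on V f \<and> functional_norm_on V f = 1}"

text \<open>
  The library's \<open>extreme_point_of\<close> needs a real vector space type, which a function type is not;
  hence extremality in \<open>states V\<close> is spelled out.
\<close>

definition pure_state_on ::
    "(complex ^ 'x ^ 'x) set \<Rightarrow> (complex ^ 'x ^ 'x \<Rightarrow> complex) \<Rightarrow> bool" where
  "pure_state_on V f \<longleftrightarrow> f \<in> states V \<and>
     (\<forall>g\<in>states V. \<forall>h\<in>states V. \<forall>t::real. 0 < t \<and> t < 1 \<and>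
        (\<forall>A\<in>V. f A = of_real (1 - t) * g A + of_real t * h A) \<longrightarrow> g = f \<and> h = f)"

definition generated_equiv :: "'x set \<Rightarrow> ('x \<times> 'x) set \<Rightarrow> ('x \<times> 'x) set" where
  "generated_equiv S Q = \<Inter>{T. equiv S T \<and> Q \<subseteq> T}"

end

theory Submission
  imports Defs
begin

text \<open>
  Write \<open>\<phi>\<close> for the vector state of the unit vector \<open>v\<close>, whose support is \<open>S\<close>.

  If \<open>S\<close> splits into two nonempty parts with no pair of \<open>R\<close> between them, then \<open>v = v\<^sub>1 + v\<^sub>2\<close> along
  the splitting, and the cross terms \<open>\<langle>v\<^sub>1, A v\<^sub>2\<rangle>\<close> and \<open>\<langle>v\<^sub>2, A v\<^sub>1\<rangle>\<close> vanish for \<open>A \<in> E R\<close>. So on \<open>E R\<close>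
  the state \<open>\<phi>\<close> is a proper convex combination of the vector states of the normalised \<open>v\<^sub>1\<close> and
  \<open>v\<^sub>2\<close>, which already differ on a diagonal matrix unit (\<open>not_pure_if_split\<close>). A failure of \<open>R\<close> to
  generate \<open>S \<times> S\<close> provides such a splitting, into an equivalence class and its complement.

  Conversely let \<open>\<phi>\<close> on \<open>E R\<close> be a proper convex combination of two states, one of them \<open>g\<close>. Then
  \<open>g\<close> vanishes on every positive element of \<open>E R\<close> on which \<open>\<phi>\<close> vanishes. No extension of \<open>g\<close> to
  all matrices is needed: for a pair \<open>(x, y) \<in> R\<close>, symmetry and reflexivity put the whole two-by-two
  matrix algebra on \<open>{x, y}\<close> inside \<open>E R\<close>, and there \<open>\<phi>\<close> comes from the single vector
  \<open>(v\<^sub>x, v\<^sub>y)\<close>. Every vector of \<open>span {e\<^sub>x, e\<^sub>y}\<close> orthogonal to it is a null vector of the positive form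
  defined by \<open>g\<close>, so by a Cauchy-Schwarz argument (\<open>positive_functional_null_vector\<close>) it lies in
  the radical of that form; hence \<open>g\<close> is a multiple of \<open>\<phi>\<close> on this block. Blocks with a common
  index in \<open>S\<close> share the diagonal entry at that index, where \<open>\<phi>\<close> is nonzero, so they have the
  same multiple. When \<open>R\<close> connects \<open>S\<close>, a single
  constant serves everywhere, and it is \<open>1\<close> because \<open>g\<close> is positive of norm one
  (\<open>dominated_state_eq_vector_state\<close>).
\<close>

section \<open>Operators with entries in a relation\<close>

lemma in_E_iff:
  fixes R :: "('x::finite \<times> 'x) set"
  shows "A \<in> E R \<longleftrightarrow> (\<forall>x y. (x, y) \<notin> R \<longrightarrow> A $ x $ y = 0)"
proof
  assume "A \<in> E R"
  then show "\<forall>x y. (x, y) \<notin> R \<longrightarrow> A $ x $ y = 0"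
    unfolding E_def
  proof (induction rule: cmat.span_induct_alt)
    case base
    then show ?case by simp
  next
    case (step c B A)
    then show ?case by (force simp: matrix_unit_def cscale_def)
  qed
next
  assume supp: "\<forall>x y. (x, y) \<notin> R \<longrightarrow> A $ x $ y = 0"
  have "A = (\<Sum>x\<in>UNIV. \<Sum>y\<in>UNIV. cscale (A $ x $ y) (matrix_unit x y))"
    unfolding vec_eq_iff
  proof (intro allI)
    fix i j
    have "(\<Sum>x\<in>UNIV. \<Sum>y\<in>UNIV. cscale (A $ x $ y) (matrix_unit x y)) $ i $ j
        = (\<Sum>x\<in>UNIV. \<Sum>y\<in>UNIV. if y = j then (if x = i then A $ x $ y else 0) else 0)"
      unfolding sum_component
      by (intro sum.cong refl) (auto simp: cscale_def matrix_unit_def)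
    then show "A $ i $ j
        = (\<Sum>x\<in>UNIV. \<Sum>y\<in>UNIV. cscale (A $ x $ y) (matrix_unit x y)) $ i $ j"
      by simp
  qed
  also have "\<dots> \<in> E R"
    unfolding E_def
  proof (intro cmat.span_sum)
    fix x y
    show "cscale (A $ x $ y) (matrix_unit x y) \<in> cmat.span {matrix_unit x y |x y. (x, y) \<in> R}"
    proof (cases "(x, y) \<in> R")
      case True
      then show ?thesis by (blast intro: cmat.span_scale cmat.span_base)
    next
      case False
      with supp show ?thesis by (simp add: cmat.span_zero)
    qed
  qed
  finally show "A \<in> E R" .
qed

section \<open>Vector states\<close>

lemma vector_state_add: "vector_state v (A + B) = vector_state v A + vector_state v B"
  by (simp add: vector_state_def cinner_def matrix_vector_mult_add_rdistrib
      distrib_left sum.distrib)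

lemma vector_state_cscale: "vector_state v (cscale c A) = c * vector_state v A"
  by (simp add: vector_state_def cinner_def matrix_vector_mult_def cscale_def
      sum_distrib_left mult_ac)

lemma vector_state_eq_sum:
  "vector_state v A = (\<Sum>i\<in>UNIV. \<Sum>j\<in>UNIV. cnj (v $ i) * A $ i $ j * v $ j)"
  by (simp add: vector_state_def cinner_def matrix_vector_mult_def sum_distrib_left mult_ac)

lemma cinner_self: "cinner v v = of_real ((norm v)\<^sup>2)"
  for v :: "complex ^ 'x::finite"
proof -
  have "cinner v v = (\<Sum>x\<in>UNIV. of_real ((cmod (v $ x))\<^sup>2))"
    unfolding cinner_def
    by (intro sum.cong refl) (simp only: complex_norm_square mult.commute)
  also have "\<dots> = of_real ((norm v)\<^sup>2)"
    by (simp add: norm_vec_def L2_set_def real_sqrt_pow2 sum_nonneg)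
  finally show ?thesis .
qed

lemma norm_cinner_le: "cmod (cinner v w) \<le> norm v * norm w"
  for v w :: "complex ^ 'x::finite"
proof -
  have "cmod (cinner v w) \<le> (\<Sum>x\<in>UNIV. \<bar>cmod (v $ x)\<bar> * \<bar>cmod (w $ x)\<bar>)"
    unfolding cinner_def by (intro sum_norm_le) (simp add: norm_mult)
  also have "\<dots> \<le> norm v * norm w"
    unfolding norm_vec_def by (rule L2_set_mult_ineq)
  finally show ?thesis .
qed

lemma norm_vector_state_le:
  fixes v :: "complex ^ 'x::finite"
  assumes "norm v = 1"
  shows "cmod (vector_state v A) \<le> op_norm A"
proof -
  have "cmod (vector_state v A) \<le> norm v * norm (A *v v)"
    unfolding vector_state_def by (rule norm_cinner_le)
  also have "\<dots> \<le> op_norm A"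
    using onorm[OF matrix_vector_mul_bounded_linear[of A], of v] assms
    by (simp add: op_norm_def)
  finally show ?thesis .
qed

lemma op_norm_one: "op_norm (mat 1 :: complex ^ 'x ^ 'x::finite) \<le> 1"
  unfolding op_norm_def by (rule onorm_bound) auto

lemma mat_1_in_E: "refl R \<Longrightarrow> mat 1 \<in> E R"
  by (auto simp: in_E_iff mat_def refl_on_def)

lemma vector_state_one: "norm v = 1 \<Longrightarrow> vector_state v (mat 1) = 1"
  for v :: "complex ^ 'x::finite"
  by (simp add: vector_state_def cinner_self)

lemma E_add: "A \<in> E R \<Longrightarrow> B \<in> E R \<Longrightarrow> A + B \<in> E R"
  by (simp add: E_def cmat.span_add)

lemma E_cscale: "A \<in> E R \<Longrightarrow> cscale c A \<in> E R"
  by (simp add: E_def cmat.span_scale)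

text \<open>
  The identity lies in \<open>E R\<close> and attains the norm of a vector state. The factor \<open>c\<close> makes the lemma
  serve twice: \<open>c = 1\<close> shows that vector states restrict to states, and in general the norm of a state
  proportional to a vector state determines the modulus of the factor.
\<close>

lemma functional_norm_scaled_vector_state:
  fixes v :: "complex ^ 'x::finite"
  assumes "refl R" and "norm v = 1"
    and g: "\<And>A. A \<in> E R \<Longrightarrow> g A = c * vector_state v A"
  shows "functional_norm_on (E R) g = cmod c"
  unfolding functional_norm_on_def
proof (rule cSup_eq_maximum)
  have "cmod (g (mat 1)) = cmod c"
    using assms by (simp add: mat_1_in_E vector_state_one)
  then show "cmod c \<in> (\<lambda>A. cmod (g A)) ` {A \<in> E R. op_norm A \<le> 1}"
    using mat_1_in_E[OF \<open>refl R\<close>] op_norm_one by (metis (mono_tags, lifting) image_iff mem_Collect_eq)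
next
  fix r
  assume "r \<in> (\<lambda>A. cmod (g A)) ` {A \<in> E R. op_norm A \<le> 1}"
  then obtain A where A: "A \<in> E R" "op_norm A \<le> 1" "r = cmod (g A)"
    by blast
  have "cmod (vector_state v A) \<le> 1"
    using norm_vector_state_le[OF \<open>norm v = 1\<close>, of A] A(2) by linarith
  then show "r \<le> cmod c"
    using A g[OF A(1)] mult_left_mono[of "cmod (vector_state v A)" 1 "cmod c"]
    by (simp add: norm_mult)
qed

lemma vector_state_in_states:
  fixes v :: "complex ^ 'x::finite"
  assumes "refl R" and "norm v = 1"
  shows "restrict (vector_state v) (E R) \<in> states (E R)"
proof -
  have "functional_norm_on (E R) (restrict (vector_state v) (E R)) = cmod 1"
    by (rule functional_norm_scaled_vector_state[OF assms]) simp
  then show ?thesis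
    by (auto simp: states_def linear_functional_on_def positive_functional_on_def
        E_add E_cscale vector_state_add vector_state_cscale)
       (simp add: positive_op_def vector_state_def)
qed

section \<open>Null vectors of positive functionals\<close>

text \<open>The rank-one operator \<open>z \<mapsto> \<langle>u, z\<rangle> w\<close>.\<close>

definition outer :: "complex ^ 'x \<Rightarrow> complex ^ 'x \<Rightarrow> complex ^ 'x ^ 'x" where
  "outer w u = (\<chi> i j. w $ i * cnj (u $ j))"

lemma vector_state_outer: "vector_state v (outer w u) = cinner v w * cinner u v"
  unfolding vector_state_eq_sum outer_def cinner_def sum_product by (simp add: mult_ac)

lemma positive_outer: "positive_op (outer w w)"
proof -
  have "cinner z w * cinner w z \<in> \<real>\<^sub>\<ge>\<^sub>0" for z
  proof -
    have "cinner w z = cnj (cinner z w)"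
      by (simp add: cinner_def mult.commute)
    then show ?thesis
      by (simp add: complex_norm_square[symmetric])
  qed
  then show ?thesis
    unfolding positive_op_def vector_state_def[symmetric] vector_state_outer by blast
qed

lemma matrix_unit_eq_outer: "matrix_unit x y = outer (axis x 1) (axis y 1)"
  by (auto simp: matrix_unit_def outer_def axis_def vec_eq_iff)

text \<open>
  An affine function on the real line which is nonnegative everywhere is constant. Applied along the
  real and the imaginary axis in \<open>s\<close> this kills \<open>c + d\<close> and \<open>c - d\<close>.
\<close>

lemma nonneg_affine_form_zero:
  fixes q c d :: complex
  assumes "\<And>s. q + s * c + cnj s * d \<in> \<real>\<^sub>\<ge>\<^sub>0"
  shows "c = 0 \<and> d = 0"
proof -
  have slope: "k = 0" if "\<And>r::real. q + of_real r * k \<in> \<real>\<^sub>\<ge>\<^sub>0" for k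
  proof -
    have re: "0 \<le> Re q + r * Re k" and im: "Im q + r * Im k = 0" for r
      using that[of r] by (auto simp: complex_nonneg_Reals_iff)
    have "Im k = 0"
      using im[of 0] im[of 1] by simp
    moreover have "Re k = 0"
    proof (rule ccontr)
      assume "Re k \<noteq> 0"
      then show False
        using re[of "- (Re q + 1) / Re k"] by simp
    qed
    ultimately show ?thesis
      by (simp add: complex_eq_iff)
  qed
  have "c + d = 0"
    using assms[of "of_real r" for r] by (intro slope) (simp add: algebra_simps)
  moreover have "\<i> * (c - d) = 0"
    using assms[of "\<i> * of_real r" for r] by (intro slope) (simp add: algebra_simps)
  ultimately show ?thesis
    by (auto simp: complex_eq_iff)
qed

text \<open>
  The equality case of the Cauchy-Schwarz inequality for the form \<open>(w, u) \<mapsto> g (outer w u)\<close>: its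
  value at \<open>u + s w\<close> is nonnegative and, because \<open>w\<close> is null, has no term of second order
  in \<open>s\<close>. The subspace \<open>V\<close> is only required to contain the four rank-one operators built from
  \<open>w\<close> and \<open>u\<close>, so the lemma applies to a space of operators that is not an algebra.
\<close>

lemma positive_functional_null_vector:
  fixes w u :: "complex ^ 'x::finite"
  assumes lin: "linear_functional_on V g" and pos: "positive_functional_on V g"
    and V: "\<And>A B. A \<in> V \<Longrightarrow> B \<in> V \<Longrightarrow> A + B \<in> V" "\<And>c A. A \<in> V \<Longrightarrow> cscale c A \<in> V"
    and mem: "outer w w \<in> V" "outer w u \<in> V" "outer u w \<in> V" "outer u u \<in> V"
    and null: "g (outer w w) = 0"
  shows "g (outer w u) = 0" and "g (outer u w) = 0"
proof -
  have "g (outer u u) + s * g (outer w u) + cnj s * g (outer u w) \<in> \<real>\<^sub>\<ge>\<^sub>0" for s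
  proof -
    define z where "z = (\<chi> i. u $ i + s * w $ i)"
    have z: "outer z z = outer u u + cscale s (outer w u)
        + cscale (cnj s) (outer u w) + cscale (s * cnj s) (outer w w)"
      by (simp add: z_def outer_def cscale_def vec_eq_iff algebra_simps)
    have "outer z z \<in> V"
      unfolding z by (intro V mem)
    then have "g (outer z z) \<in> \<real>\<^sub>\<ge>\<^sub>0"
      using pos positive_outer by (auto simp: positive_functional_on_def)
    moreover have "g (outer z z) = g (outer u u) + s * g (outer w u) + cnj s * g (outer u w)"
      using lin null unfolding z linear_functional_on_def by (simp add: V mem)
    ultimately show ?thesis by simp
  qed
  from nonneg_affine_form_zero[OF this]
  show "g (outer w u) = 0" and "g (outer u w) = 0" by auto
qed

section \<open>States dominated by a vector state\<close>

lemma outer_in_E_edge: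
  fixes R :: "('x::finite \<times> 'x) set"
  assumes "refl R" "sym R" "(x, y) \<in> R"
    and "\<And>i. i \<notin> {x, y} \<Longrightarrow> w $ i = 0" "\<And>i. i \<notin> {x, y} \<Longrightarrow> u $ i = 0"
  shows "outer w u \<in> E R"
  unfolding in_E_iff
proof (intro allI impI)
  fix i j
  assume "(i, j) \<notin> R"
  moreover have "{x, y} \<times> {x, y} \<subseteq> R"
    using assms(1-3) by (auto simp: refl_on_def sym_def)
  ultimately have "i \<notin> {x, y} \<or> j \<notin> {x, y}"
    by blast
  then show "outer w u $ i $ j = 0"
    using assms(4,5) by (auto simp: outer_def)
qed

text \<open>
  On the block of \<open>{x, y}\<close> the functional \<open>g\<close> is a multiple of the vector state, whose values on
  the matrix units are \<open>cnj (v $ x) * v $ y\<close>. This is stated without division, so that zero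
  entries of \<open>v\<close> are allowed. The two equations are void when both entries are zero, which is why the
  case \<open>v $ x = 0\<close>, where \<open>e\<^sub>x\<close> itself is a null vector, is recorded separately.
\<close>

lemma dominated_edge_relation:
  fixes v :: "complex ^ 'x::finite"
  assumes R: "refl R" "sym R" and g: "g \<in> states (E R)"
    and dom: "\<And>A. A \<in> E R \<Longrightarrow> positive_op A \<Longrightarrow> vector_state v A = 0 \<Longrightarrow> g A = 0"
    and xy: "(x, y) \<in> R"
  shows "v $ y * g (matrix_unit x x) = v $ x * g (matrix_unit x y)"
    and "cnj (v $ y) * g (matrix_unit x y) = cnj (v $ x) * g (matrix_unit y y)"
    and "v $ x = 0 \<Longrightarrow> g (matrix_unit x y) = 0"
proof -
  have lin: "linear_functional_on (E R) g" and pos: "positive_functional_on (E R) g"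
    using g by (auto simp: states_def)
  have null: "g (outer w u) = 0" "g (outer u w) = 0"
    if orth: "cinner w v = 0"
      and w: "\<And>i. i \<notin> {x, y} \<Longrightarrow> w $ i = 0" and u: "\<And>i. i \<notin> {x, y} \<Longrightarrow> u $ i = 0" for w u
  proof -
    have mem: "outer w w \<in> E R" "outer w u \<in> E R" "outer u w \<in> E R" "outer u u \<in> E R"
      using outer_in_E_edge[OF R xy] w u by metis+
    have "g (outer w w) = 0"
      by (rule dom[OF mem(1) positive_outer]) (simp add: vector_state_outer orth)
    from positive_functional_null_vector[OF lin pos E_add E_cscale mem this]
    show "g (outer w u) = 0" "g (outer u w) = 0" by auto
  qed
  have units: "matrix_unit x x \<in> E R" "matrix_unit x y \<in> E R" "matrix_unit y y \<in> E R"
    using R xy by (auto simp: in_E_iff matrix_unit_def refl_on_def)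
  have cinner_axis: "cinner (axis i 1) v = v $ i" for i
    by (simp add: cinner_def axis_def if_distrib if_distribR cong: if_cong)
  \<comment> \<open>Orthogonal to \<open>v\<close>, and spanning the directions in the block that are so unless \<open>v\<close> vanishes on it.\<close>
  define w where "w = cnj (v $ y) *s axis x 1 - cnj (v $ x) *s axis y (1::complex)"
  have "cinner w v = v $ y * cinner (axis x 1) v - v $ x * cinner (axis y 1) v"
    by (simp add: w_def cinner_def left_diff_distrib sum_subtractf sum_distrib_left mult.assoc)
  then have w: "cinner w v = 0"
    by (simp add: cinner_axis)
  have w_supp: "w $ i = 0" if "i \<notin> {x, y}" for i
    using that by (auto simp: w_def axis_def)
  have g_comb: "g (cscale a A + cscale b B) = a * g A + b * g B" if "A \<in> E R" "B \<in> E R" for a b A B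
    using lin that by (simp add: linear_functional_on_def E_cscale)
  have "outer (axis x 1) w = cscale (v $ y) (matrix_unit x x) + cscale (- (v $ x)) (matrix_unit x y)"
    by (auto simp: w_def outer_def cscale_def matrix_unit_def axis_def vec_eq_iff)
  moreover have "g (outer (axis x 1) w) = 0"
    by (rule null(2)[OF w w_supp]) (auto simp: axis_def)
  ultimately show "v $ y * g (matrix_unit x x) = v $ x * g (matrix_unit x y)"
    using g_comb[OF units(1,2), of "v $ y" "- (v $ x)"] by (simp only:) simp
  have "outer w (axis y 1)
      = cscale (cnj (v $ y)) (matrix_unit x y) + cscale (- cnj (v $ x)) (matrix_unit y y)"
    by (auto simp: w_def outer_def cscale_def matrix_unit_def axis_def vec_eq_iff)
  moreover have "g (outer w (axis y 1)) = 0"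
    by (rule null(1)[OF w w_supp]) (auto simp: axis_def)
  ultimately show "cnj (v $ y) * g (matrix_unit x y) = cnj (v $ x) * g (matrix_unit y y)"
    using g_comb[OF units(2,3), of "cnj (v $ y)" "- cnj (v $ x)"] by (simp only:) simp
  show "g (matrix_unit x y) = 0" if "v $ x = 0"
    unfolding matrix_unit_eq_outer
    by (rule null(1)) (use that in \<open>auto simp: cinner_axis\<close>, auto simp: axis_def)
qed

text \<open>
  Connectedness enters only in this form: a relation that contains the pairs of \<open>Q\<close> and is an
  equivalence is everything. Applied to the equivalence of having the same factor, it makes
  a factor that agrees along pairs constant, without paths.
\<close>

lemma generated_equivD:
  assumes "generated_equiv S Q = S \<times> S" and "equiv S T" and "Q \<subseteq> T"
    and "x \<in> S" and "y \<in> S"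
  shows "(x, y) \<in> T"
  using assms unfolding generated_equiv_def by blast

lemma vector_state_matrix_unit: "vector_state v (matrix_unit x y) = cnj (v $ x) * v $ y"
  for v :: "complex ^ 'x::finite"
  by (simp add: matrix_unit_eq_outer vector_state_outer cinner_def axis_def
      if_distrib if_distribR cong: if_cong)

text \<open>
  The state \<open>g\<close> is proportional to the vector state on every block. The factor at \<open>x \<in> S\<close> can be
  read off from the diagonal entry, so it does not depend on the block, and any two members of a pair
  in \<open>S\<close> have the same one.
\<close>

lemma dominated_state_eq_vector_state:
  fixes v :: "complex ^ 'x::finite"
  assumes R: "refl R" "sym R" and v: "norm v = 1"
    and conn: "generated_equiv (support v) (Restr R (support v)) = support v \<times> support v"
    and g: "g \<in> states (E R)"
    and dom: "\<And>A. A \<in> E R \<Longrightarrow> positive_op A \<Longrightarrow> vector_state v A = 0 \<Longrightarrow> g A = 0"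
  shows "g = restrict (vector_state v) (E R)"
proof -
  define S where "S = support v"
  \<comment> \<open>The factor between \<open>g\<close> and the vector state, as seen at the diagonal entry of \<open>x\<close>.\<close>
  define k where "k x = g (matrix_unit x x) / (cnj (v $ x) * v $ x)" for x
  have S: "x \<in> S \<longleftrightarrow> v $ x \<noteq> 0" for x
    by (simp add: S_def support_def)
  note edge = dominated_edge_relation[OF R g dom]
  have unit: "g (matrix_unit x y) = k x * (cnj (v $ x) * v $ y)" if "(x, y) \<in> R" "x \<in> S" for x y
    using edge(1)[OF _ _ _ that(1)] that(2) by (simp add: k_def S field_simps)
  define T where "T = {(x, y) \<in> S \<times> S. k x = k y}"
  have "equiv S T"
    by (auto simp: T_def equiv_def refl_on_def sym_def trans_def)
  moreover have "Restr R S \<subseteq> T"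
  proof clarify
    fix x y
    assume xy: "(x, y) \<in> R" "x \<in> S" "y \<in> S"
    have "cnj (v $ x) * g (matrix_unit y y) = cnj (v $ y) * (k x * (cnj (v $ x) * v $ y))"
      using edge(2)[OF _ _ _ xy(1)] unit[OF xy(1,2)] by simp
    then have "k y = k x"
      using xy(2,3) by (simp add: k_def[of y] S field_simps)
    then show "(x, y) \<in> T"
      using xy by (simp add: T_def)
  qed
  ultimately have const: "k x = k y" if "x \<in> S" "y \<in> S" for x y
    using generated_equivD[OF conn[folded S_def] _ _ that, of T] by (simp add: T_def)
  obtain a where a: "a \<in> S"
  proof -
    have "v \<noteq> 0" using v by auto
    then show ?thesis using that by (auto simp: S vec_eq_iff)
  qed
  have unit_scaled: "g (matrix_unit x y) = k a * vector_state v (matrix_unit x y)"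
    if xy: "(x, y) \<in> R" for x y
  proof (cases "x \<in> S")
    case True
    then show ?thesis
      using unit[OF xy True] const[OF True a] by (simp add: vector_state_matrix_unit)
  next
    case False
    then show ?thesis
      using edge(3)[OF _ _ _ xy] by (simp add: S vector_state_matrix_unit)
  qed
  have lin: "linear_functional_on (E R) g"
    using g by (simp add: states_def)
  have scaled: "g A = k a * vector_state v A" if "A \<in> E R" for A
  proof -
    have "A \<in> E R \<and> g A = k a * vector_state v A"
      using that[unfolded E_def]
    proof (induction rule: cmat.span_induct_alt)
      case base
      have "g (cscale 0 (mat 1)) = 0 * g (mat 1)"
        using lin mat_1_in_E[OF R(1)] unfolding linear_functional_on_def by blast
      then show ?case
        by (simp add: E_def cmat.span_zero vector_state_eq_sum)
    next
      case (step c B A)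
      then have B: "B \<in> E R" "g B = k a * vector_state v B"
        using unit_scaled by (auto simp: E_def intro: cmat.span_base)
      then show ?case
        using lin step unfolding linear_functional_on_def
        by (simp add: E_add E_cscale vector_state_add vector_state_cscale algebra_simps)
    qed
    then show ?thesis by simp
  qed
  have "cmod (k a) = 1"
    using functional_norm_scaled_vector_state[OF R(1) v scaled] g by (simp add: states_def)
  moreover have "k a \<in> \<real>\<^sub>\<ge>\<^sub>0"
  proof -
    have "matrix_unit a a \<in> E R"
      using R by (auto simp: in_E_iff matrix_unit_def refl_on_def)
    then have "g (matrix_unit a a) \<in> \<real>\<^sub>\<ge>\<^sub>0"
      using g positive_outer[of "axis a 1"]
      by (simp add: states_def positive_functional_on_def matrix_unit_eq_outer)
    moreover have "cnj (v $ a) * v $ a = of_real ((cmod (v $ a))\<^sup>2)"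
      by (simp only: complex_norm_square mult.commute)
    ultimately show ?thesis
      unfolding k_def by (simp add: nonneg_Reals_divide_I)
  qed
  ultimately have "k a = 1"
    by (auto elim!: nonneg_Reals_cases)
  then show ?thesis
    using lin scaled by (auto simp: linear_functional_on_def extensional_def restrict_def)
qed

section \<open>Purity and connectedness\<close>

lemma component_of_convex_combination_dominated:
  assumes "g \<in> states V" and "h \<in> states V" and "0 < t" and "t < 1"
    and comb: "f A = of_real (1 - t) * g A + of_real t * h A"
    and "A \<in> V" and "positive_op A" and "f A = 0"
  shows "g A = 0"
proof -
  have "g A \<in> \<real>\<^sub>\<ge>\<^sub>0" "h A \<in> \<real>\<^sub>\<ge>\<^sub>0"
    using assms by (auto simp: states_def positive_functional_on_def)
  then obtain p q where pq: "g A = of_real p" "h A = of_real q" "0 \<le> p" "0 \<le> q"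
    by (auto elim!: nonneg_Reals_cases)
  have "of_real ((1 - t) * p + t * q) = (0 :: complex)"
    using comb \<open>f A = 0\<close> pq by simp
  then have "(1 - t) * p + t * q = 0"
    using of_real_eq_0_iff by blast
  moreover have "0 \<le> (1 - t) * p" "0 \<le> t * q"
    using pq assms by auto
  ultimately have "(1 - t) * p = 0" by linarith
  then show ?thesis using pq assms by simp
qed

lemma pure_if_connected:
  fixes v :: "complex ^ 'x::finite"
  assumes R: "refl R" "sym R" and v: "norm v = 1"
    and conn: "generated_equiv (support v) (Restr R (support v)) = support v \<times> support v"
  shows "pure_state_on (E R) (restrict (vector_state v) (E R))"
  unfolding pure_state_on_def
proof (intro conjI ballI allI impI vector_state_in_states R v)
  fix g h and t :: real
  assume g: "g \<in> states (E R)" and h: "h \<in> states (E R)"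
  assume comb: "0 < t \<and> t < 1 \<and> (\<forall>A\<in>E R. restrict (vector_state v) (E R) A
      = of_real (1 - t) * g A + of_real t * h A)"
  then have t: "0 < t" "t < 1"
    and comb1: "A \<in> E R \<Longrightarrow> vector_state v A = of_real (1 - t) * g A + of_real t * h A"
    and comb2: "A \<in> E R \<Longrightarrow> vector_state v A
        = of_real (1 - (1 - t)) * h A + of_real (1 - t) * g A" for A
    by (auto simp: add.commute)
  show "g = restrict (vector_state v) (E R)"
    by (rule dominated_state_eq_vector_state[OF R v conn g])
       (rule component_of_convex_combination_dominated[OF g h t comb1])
  show "h = restrict (vector_state v) (E R)"
    by (rule dominated_state_eq_vector_state[OF R v conn h])
       (rule component_of_convex_combination_dominated[OF h g _ _ comb2], use t in auto)
qed

lemma vector_state_scaleR: "vector_state (r *\<^sub>R v) A = of_real (r\<^sup>2) * vector_state v A"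
  by (simp add: vector_state_eq_sum sum_distrib_left power2_eq_square)
     (simp add: scaleR_conv_of_real mult_ac)

text \<open>
  Cutting \<open>v\<close> along \<open>C\<close> loses only cross terms, and these involve entries outside \<open>R\<close>, which vanish on
  \<open>E R\<close>. The two pieces, normalised, have weights \<open>norm v\<^sub>1 ^ 2\<close> and \<open>norm v\<^sub>2 ^ 2\<close>. They give different
  states since the second one vanishes at \<open>a\<close> but \<open>v\<close> does not.
\<close>

lemma not_pure_if_split:
  fixes v :: "complex ^ 'x::finite"
  assumes R: "refl R" and v: "norm v = 1"
    and a: "a \<in> C" "v $ a \<noteq> 0" and b: "b \<notin> C" "v $ b \<noteq> 0"
    and split: "\<And>x y. (x, y) \<in> R \<Longrightarrow> v $ x \<noteq> 0 \<Longrightarrow> v $ y \<noteq> 0 \<Longrightarrow> x \<in> C \<longleftrightarrow> y \<in> C"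
  shows "\<not> pure_state_on (E R) (restrict (vector_state v) (E R))"
proof
  assume pure: "pure_state_on (E R) (restrict (vector_state v) (E R))"
  define v1 where "v1 = (\<chi> i. if i \<in> C then v $ i else 0)"
  define v2 where "v2 = (\<chi> i. if i \<in> C then 0 else v $ i)"
  define u1 where "u1 = (1 / norm v1) *\<^sub>R v1"
  define u2 where "u2 = (1 / norm v2) *\<^sub>R v2"
  have "v1 $ a \<noteq> 0" "v2 $ b \<noteq> 0"
    using a b by (auto simp: v1_def v2_def)
  then have pos: "norm v1 \<noteq> 0" "norm v2 \<noteq> 0"
    by auto
  then have u: "norm u1 = 1" "norm u2 = 1"
    by (auto simp: u1_def u2_def)
  have sum: "vector_state v A = vector_state v1 A + vector_state v2 A" if "A \<in> E R" for A
    unfolding vector_state_eq_sum sum.distrib[symmetric]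
  proof (intro sum.cong refl)
    fix i j
    show "cnj (v $ i) * A $ i $ j * v $ j
        = cnj (v1 $ i) * A $ i $ j * v1 $ j + cnj (v2 $ i) * A $ i $ j * v2 $ j"
    proof (cases "(i, j) \<in> R \<and> v $ i \<noteq> 0 \<and> v $ j \<noteq> 0")
      case True
      then show ?thesis
        using split[of i j] by (simp add: v1_def v2_def)
    next
      case False
      then show ?thesis
        using that by (auto simp: v1_def v2_def in_E_iff)
    qed
  qed
  define t where "t = (norm v2)\<^sup>2"
  \<comment> \<open>The weights add up to one: evaluate the decomposition at the identity.\<close>
  have "complex_of_real 1 = of_real ((norm v1)\<^sup>2 + (norm v2)\<^sup>2)"
    using sum[OF mat_1_in_E[OF R]] v
    by (simp add: vector_state_def cinner_self)
  then have norms: "(norm v1)\<^sup>2 = 1 - t"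
    unfolding of_real_eq_iff t_def by simp
  have t: "0 < t" "t < 1"
    using pos norms zero_less_power2[of "norm v1"] zero_less_power2[of "norm v2"]
    unfolding t_def by linarith+
  have u1: "of_real (1 - t) * vector_state u1 A = vector_state v1 A" for A
    using pos unfolding norms[symmetric] u1_def vector_state_scaleR
    by (simp add: power_divide)
  have u2: "of_real t * vector_state u2 A = vector_state v2 A" for A
    using pos unfolding t_def u2_def vector_state_scaleR
    by (simp add: power_divide)
  have "\<forall>A\<in>E R. restrict (vector_state v) (E R) A
      = of_real (1 - t) * restrict (vector_state u1) (E R) A
        + of_real t * restrict (vector_state u2) (E R) A"
    using sum by (simp add: u1 u2 del: of_real_diff)
  then have eq: "restrict (vector_state u1) (E R) = restrict (vector_state v) (E R)"
    "restrict (vector_state u2) (E R) = restrict (vector_state v) (E R)"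
    using pure vector_state_in_states[OF R u(1)] vector_state_in_states[OF R u(2)] t
    unfolding pure_state_on_def by blast+
  have mem: "matrix_unit a a \<in> E R"
    using R by (auto simp: in_E_iff matrix_unit_def refl_on_def)
  have "vector_state u2 (matrix_unit a a) = vector_state v (matrix_unit a a)"
    using fun_cong[OF eq(2), of "matrix_unit a a"] mem by simp
  then show False
    using a by (simp add: vector_state_matrix_unit u2_def v2_def)
qed

lemma connected_if_pure:
  fixes v :: "complex ^ 'x::finite"
  assumes R: "refl R" and v: "norm v = 1"
    and pure: "pure_state_on (E R) (restrict (vector_state v) (E R))"
  shows "generated_equiv (support v) (Restr R (support v)) = support v \<times> support v"
proof (rule ccontr)
  let ?S = "support v"
  assume ne: "generated_equiv ?S (Restr R ?S) \<noteq> ?S \<times> ?S"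
  have "equiv ?S (?S \<times> ?S)"
    by (auto simp: equiv_def refl_on_def sym_def trans_def)
  then have "generated_equiv ?S (Restr R ?S) \<subseteq> ?S \<times> ?S"
    by (auto simp: generated_equiv_def)
  with ne obtain a b where ab: "a \<in> ?S" "b \<in> ?S" "(a, b) \<notin> generated_equiv ?S (Restr R ?S)"
    by blast
  then obtain T where T: "equiv ?S T" "Restr R ?S \<subseteq> T" "(a, b) \<notin> T"
    by (auto simp: generated_equiv_def)
  have "\<not> pure_state_on (E R) (restrict (vector_state v) (E R))"
  proof (rule not_pure_if_split[OF R v])
    show "a \<in> T `` {a}"
      using equiv_class_self[OF T(1) ab(1)] .
    show "b \<notin> T `` {a}"
      using T(3) by simp
    show "v $ a \<noteq> 0" "v $ b \<noteq> 0"
      using ab by (auto simp: support_def)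
    fix x y
    assume "(x, y) \<in> R" "v $ x \<noteq> 0" "v $ y \<noteq> 0"
    then have "(x, y) \<in> T"
      using T(2) by (auto simp: support_def)
    then show "x \<in> T `` {a} \<longleftrightarrow> y \<in> T `` {a}"
      using T(1) by (auto elim!: equivE dest: symD transD)
  qed
  with pure show False by simp
qed

theorem proposition3p11:
  fixes R :: "('x::finite \<times> 'x) set"
    and \<phi> :: "complex ^ 'x ^ 'x \<Rightarrow> complex"
    and v :: "complex ^ 'x"
    and S :: "'x set"
  assumes "refl R" and "sym R"
    and "norm v = 1" and "\<phi> = vector_state v" and "S = support v"
  shows "pure_state_on (E R) (restrict \<phi> (E R)) \<longleftrightarrow>
         generated_equiv S (Restr R S) = S \<times> S"
  using assms connected_if_pure pure_if_connected by blast

end
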